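(* Let $p$ be a prime and let $x\ge 1$ be real. Then $$\Delta(x,p)=\frac{3}{\pi^{2}(p+1)}\,x^{2}+O(x\log x),$$ where the implied constant is absolute.
   Context: Here $\varphi$ denotes Euler's totient function, and for a prime $p$ and real $x\ge 1$, $\Delta(x,p)=\sum_{\substack{k\le x\\ p\mid k}}\varphi(k)$, the sum being over positive integers $k\le x$ divisible by $p$ (an empty sum is $0$).
   Formalization: The bound is stated for real x ≥ 2 instead of x ≥ 1, since at x = 1 the sum Δ(1,p) and x log x are both 0 while the main term 3/(π²(p+1)) is positive, so no constant works near 1. *)

theory Defs
  imports Complex_Main "HOL-Number_Theory.Totient"
begin

definition Delta :: "real \<Rightarrow> nat \<Rightarrow> nat" where
  "Delta x p = (\<Sum>k | 1 \<le> k \<and> real k \<le> x \<and> p dvd k. totient k)"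

end

theory Submission
  imports Defs "HOL-Analysis.Gamma_Function" "HOL-Computational_Algebra.Squarefree"
begin

text \<open>
  Write \<open>\<Phi> y\<close> for the summatory totient function \<open>Delta y 1\<close> and \<open>c = 3 / pi\<^sup>2\<close>.  The proof deduces
  the estimate for multiples of a prime from \<open>\<Phi> y = c * y\<^sup>2 + O(y log y)\<close>.

  For the latter, put \<open>H y = \<Phi> y - c * y\<^sup>2\<close>.  The sum of \<open>H (y / d)\<close> over \<open>1 \<le> d \<le> y\<close> is only \<open>O(y)\<close>
  (\<open>dilation_sum_bound\<close>): by Gauss's divisor sum \<open>\<Sum>d | d dvd n. totient d = n\<close> the part from \<open>\<Phi>\<close> is
  the sum of the integers up to \<open>y\<close>, hence \<open>y\<^sup>2 / 2 + O(y)\<close>, while the part from the main term is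
  \<open>c * y\<^sup>2 * (pi\<^sup>2 / 6) + O(y) = y\<^sup>2 / 2 + O(y)\<close>, and the constant \<open>c\<close> is the one for which the quadratic
  terms cancel.  Moebius inversion recovers \<open>H y\<close> from these sums with coefficients
  bounded by 1, at the price of one harmonic sum (\<open>bound_from_dilation_sums\<close>).  Inverting the
  difference \<open>H\<close>, rather than \<open>\<Phi>\<close> alone, avoids the separate evaluation of
  \<open>\<Sum>d. moebius d / d\<^sup>2\<close>.

  To pass to multiples of \<open>p\<close>, write them as \<open>p * m\<close>.  Since \<open>totient (p * m)\<close> is \<open>(p - 1) * totient m\<close>,
  with a further \<open>totient m\<close> if \<open>p\<close> divides \<open>m\<close>, one gets
  \<open>Delta x p = (p - 1) * \<Phi> (x / p) + Delta (x / p) p\<close> (\<open>Delta_recurrence\<close>).  The main term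
  \<open>c * x\<^sup>2 / (p + 1)\<close> satisfies the same recurrence with \<open>c * y\<^sup>2\<close> in place of \<open>\<Phi> y\<close>, and an error
  bound \<open>2 * y * L\<close> with fixed \<open>L\<close> satisfies it exactly, as \<open>(p - 1) / p + 1 / p = 1\<close>.  So the bound for
  \<open>\<Phi>\<close> carries over with the same constant for every prime, which is the uniformity claimed.
\<close>

section \<open>The Moebius function\<close>

definition moebius :: "nat \<Rightarrow> real" where
  "moebius n = (if squarefree n then (-1) ^ card (prime_factors n) else 0)"

lemma abs_moebius_le_1: "\<bar>moebius n\<bar> \<le> 1"
  by (simp add: moebius_def power_abs)

lemma moebius_prime_mult:
  assumes "prime p" "\<not> p dvd d"
  shows "moebius (p * d) = - moebius d"
proof -
  have "d \<noteq> 0" "p \<noteq> 0"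
    using assms by (auto intro: ccontr)
  moreover have "coprime p d"
    using assms by (simp add: prime_imp_coprime)
  moreover have "p \<notin> prime_factors d"
    using assms by auto
  ultimately show ?thesis
    using assms squarefree_prime[of p]
    by (auto simp: moebius_def prime_factors_product prime_prime_factors
        dest: squarefree_multD intro: squarefree_mult_coprime)
qed

text \<open>
  For \<open>n > 1\<close> choose a prime \<open>p\<close> dividing \<open>n\<close>: the squarefree divisors of \<open>n\<close> come in pairs \<open>d\<close>, \<open>p * d\<close>
  with \<open>p\<close> not dividing \<open>d\<close>, and \<open>moebius\<close> takes opposite values on each pair.
\<close>
lemma sum_moebius_divisors:
  assumes "n > 0"
  shows "(\<Sum>d | d dvd n. moebius d) = (if n = 1 then 1 else 0)"
proof (cases "n = 1")
  case True
  thus ?thesis by (simp add: moebius_def)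
next
  case False
  then obtain p where p: "prime p" "p dvd n"
    using prime_factor_nat by blast
  define A where "A = {d. d dvd n \<and> squarefree d}"
  define B where "B = {d \<in> A. \<not> p dvd d}"
  have fin: "finite {d. d dvd n}"
    using assms by simp
  have finA: "finite A" "finite B"
    using fin by (auto simp: A_def B_def)
  have "p > 0"
    using p by (simp add: prime_gt_0_nat)
  have A_eq: "A = B \<union> (*) p ` B"
  proof (intro equalityI subsetI)
    fix d assume d: "d \<in> A"
    show "d \<in> B \<union> (*) p ` B"
    proof (cases "p dvd d")
      case True
      then obtain e where e: "d = p * e" by blast
      have "\<not> p dvd e"
      proof
        assume "p dvd e"
        hence "p\<^sup>2 dvd d" by (simp add: e power2_eq_square)
        thus False
          using d p squarefreeD[of d p] by (auto simp: A_def)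
      qed
      moreover have "e dvd n" "squarefree e"
        using d e by (auto simp: A_def dest: squarefree_multD dvd_mult_right)
      ultimately have "e \<in> B" by (simp add: A_def B_def)
      thus ?thesis using e by blast
    qed (use d in \<open>simp add: B_def\<close>)
  next
    fix d assume "d \<in> B \<union> (*) p ` B"
    thus "d \<in> A"
    proof
      assume "d \<in> (*) p ` B"
      then obtain e where e: "d = p * e" "e dvd n" "squarefree e" "\<not> p dvd e"
        by (auto simp: A_def B_def)
      have "coprime p e"
        using p e by (simp add: prime_imp_coprime)
      thus "d \<in> A"
        using p e by (auto simp: A_def intro!: divides_mult squarefree_mult_coprime squarefree_prime[OF p(1)])
    qed (simp add: B_def)
  qed
  have "(\<Sum>d | d dvd n. moebius d) = sum moebius A"
    by (rule sum.mono_neutral_right[OF fin]) (auto simp: A_def moebius_def)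
  also have "\<dots> = sum moebius B + sum moebius ((*) p ` B)"
    unfolding A_eq by (rule sum.union_disjoint) (use finA in \<open>auto simp: B_def\<close>)
  also have "sum moebius ((*) p ` B) = (\<Sum>d\<in>B. moebius (p * d))"
    using \<open>p > 0\<close> by (subst sum.reindex) (auto simp: inj_on_def)
  also have "\<dots> = - sum moebius B"
    unfolding sum_negf[symmetric]
    by (rule sum.cong) (use p in \<open>auto simp: B_def moebius_prime_mult\<close>)
  finally show ?thesis using False by simp
qed

section \<open>Inversion of sums over dilations\<close>

text \<open>
  Both sides run over the pairs with \<open>d * e \<le> N\<close>, grouped on the right by the product \<open>n = d * e\<close>.
\<close>
lemma sum_over_factorizations:
  fixes f :: "nat \<Rightarrow> nat \<Rightarrow> 'a :: comm_monoid_add"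
  shows "(\<Sum>d=1..N. \<Sum>e=1..N div d. f d e) = (\<Sum>n=1..N. \<Sum>d | d dvd n. f d (n div d))"
proof -
  have "(\<Sum>d=1..N. \<Sum>e=1..N div d. f d e)
      = (\<Sum>(d,e)\<in>(SIGMA d:{1..N}. {1..N div d}). f d e)"
    by (rule sum.Sigma) auto
  also have "\<dots> = (\<Sum>(n,d)\<in>(SIGMA n:{1..N}. {d. d dvd n}). f d (n div d))"
  proof (rule sum.reindex_bij_witness[where i = "\<lambda>(n,d). (d, n div d)" and j = "\<lambda>(d,e). (d * e, d)"];
         clarsimp)
    fix d e assume "Suc 0 \<le> d" "Suc 0 \<le> e" "e \<le> N div d"
    thus "d * e \<le> N"
      by (metis div_times_less_eq_dividend mult.commute mult_le_mono2 order.trans)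
  next
    fix n d assume *: "Suc 0 \<le> n" "n \<le> N" "d dvd n"
    hence "d \<le> n" "d > 0"
      by (auto intro: dvd_imp_le dvd_pos_nat)
    with * show "Suc 0 \<le> d \<and> d \<le> N \<and> Suc 0 \<le> n div d \<and> n div d \<le> N div d"
      by (auto simp: Suc_le_eq div_greater_zero_iff div_le_mono)
  qed
  also have "\<dots> = (\<Sum>n=1..N. \<Sum>d | d dvd n. f d (n div d))"
    by (rule sum.Sigma[symmetric]) auto
  finally show ?thesis .
qed

lemma nat_floor_divide_nat: "nat \<lfloor>y / real d\<rfloor> = nat \<lfloor>y\<rfloor> div d"
  by (metis floor_divide_real_eq_div nat_div_distrib' nat_int of_int_of_nat_eq of_nat_0_le_iff)

text \<open>
  Grouping the double sum by \<open>n = d * e\<close>, the value \<open>H (y / n)\<close> receives the coefficient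
  \<open>\<Sum>d | d dvd n. moebius d\<close>, so only \<open>n = 1\<close> survives.
\<close>
lemma moebius_inversion_dilations:
  fixes H :: "real \<Rightarrow> real"
  assumes "y \<ge> 1"
  shows "(\<Sum>d=1..nat \<lfloor>y\<rfloor>. moebius d * (\<Sum>e=1..nat \<lfloor>y / real d\<rfloor>. H (y / real d / real e))) = H y"
proof -
  let ?N = "nat \<lfloor>y\<rfloor>"
  have N: "?N \<ge> 1" using assms by (simp add: le_nat_floor)
  have "(\<Sum>d=1..?N. moebius d * (\<Sum>e=1..nat \<lfloor>y / real d\<rfloor>. H (y / real d / real e)))
      = (\<Sum>d=1..?N. \<Sum>e=1..?N div d. moebius d * H (y / real d / real e))"
    by (simp add: nat_floor_divide_nat sum_distrib_left)
  also have "\<dots> = (\<Sum>n=1..?N. \<Sum>d | d dvd n. moebius d * H (y / real d / real (n div d)))"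
    by (rule sum_over_factorizations)
  also have "\<dots> = (\<Sum>n=1..?N. if n = 1 then H y else 0)"
  proof (rule sum.cong)
    fix n assume n: "n \<in> {1..?N}"
    have "(\<Sum>d | d dvd n. moebius d * H (y / real d / real (n div d)))
        = (\<Sum>d | d dvd n. moebius d) * H (y / real n)"
      unfolding sum_distrib_right
    proof (rule sum.cong)
      fix d assume "d \<in> {d. d dvd n}"
      then obtain e where "n = d * e" by auto
      thus "moebius d * H (y / real d / real (n div d)) = moebius d * H (y / real n)"
        using n by auto
    qed simp
    thus "(\<Sum>d | d dvd n. moebius d * H (y / real d / real (n div d))) = (if n = 1 then H y else 0)"
      using n by (simp add: sum_moebius_divisors)
  qed simp
  also have "\<dots> = H y" using N by simp
  finally show ?thesis .
qed

text \<open>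
  The difference between the harmonic numbers and the logarithm decreases from its initial value 1.
\<close>
lemma harmonic_sum_le:
  assumes "y \<ge> 1"
  shows "(\<Sum>d=1..nat \<lfloor>y\<rfloor>. 1 / real d) \<le> 1 + ln y"
proof -
  let ?N = "nat \<lfloor>y\<rfloor>"
  obtain m where m: "?N = Suc m"
    using assms by (metis le_nat_floor Suc_le_D One_nat_def of_nat_1)
  have "harm (Suc m) - ln (real (Suc m)) \<le> harm (Suc 0) - ln (real (Suc 0))"
    using decseqD[OF decseq_harm_diff_ln, of 0 m] by simp
  hence "harm ?N \<le> 1 + ln (real ?N)"
    by (simp add: m harm_expand)
  also have "ln (real ?N) \<le> ln y"
    using assms m by (subst ln_le_cancel_iff) (auto simp: of_nat_floor simp flip: m)
  finally show ?thesis by (simp add: harm_def inverse_eq_divide)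
qed

text \<open>
  After inversion the hypothesis is applied at \<open>z = y / d\<close>; summing \<open>K * y / d\<close> over \<open>d \<le> y\<close> costs the
  factor \<open>1 + ln y\<close>.
\<close>
lemma bound_from_dilation_sums:
  fixes H :: "real \<Rightarrow> real"
  assumes "\<And>z. z \<ge> 1 \<Longrightarrow> \<bar>\<Sum>d=1..nat \<lfloor>z\<rfloor>. H (z / real d)\<bar> \<le> K * z"
    and "y \<ge> 1" and "K \<ge> 0"
  shows "\<bar>H y\<bar> \<le> K * y * (1 + ln y)"
proof -
  let ?G = "\<lambda>z. \<Sum>d=1..nat \<lfloor>z\<rfloor>. H (z / real d)"
  have "\<bar>H y\<bar> = \<bar>\<Sum>d=1..nat \<lfloor>y\<rfloor>. moebius d * ?G (y / real d)\<bar>"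
    by (simp only: moebius_inversion_dilations[OF \<open>y \<ge> 1\<close>])
  also have "\<dots> \<le> (\<Sum>d=1..nat \<lfloor>y\<rfloor>. \<bar>moebius d * ?G (y / real d)\<bar>)"
    by (rule sum_abs)
  also have "\<dots> \<le> (\<Sum>d=1..nat \<lfloor>y\<rfloor>. K * y * (1 / real d))"
  proof (rule sum_mono)
    fix d assume d: "d \<in> {1..nat \<lfloor>y\<rfloor>}"
    hence "real d \<le> y"
      using assms(2) by (simp add: le_nat_iff le_floor_iff)
    hence "y / real d \<ge> 1" using d by simp
    hence "\<bar>?G (y / real d)\<bar> \<le> K * (y / real d)" by (rule assms(1))
    hence "\<bar>moebius d\<bar> * \<bar>?G (y / real d)\<bar> \<le> 1 * (K * (y / real d))"
      by (intro mult_mono abs_moebius_le_1) auto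
    thus "\<bar>moebius d * ?G (y / real d)\<bar> \<le> K * y * (1 / real d)"
      by (simp add: abs_mult)
  qed
  also have "\<dots> = K * y * (\<Sum>d=1..nat \<lfloor>y\<rfloor>. 1 / real d)"
    by (simp only: sum_distrib_left)
  also have "\<dots> \<le> K * y * (1 + ln y)"
    using assms by (intro mult_left_mono harmonic_sum_le) auto
  finally show ?thesis .
qed

section \<open>The summatory totient function\<close>

lemma Delta_1: "Delta y 1 = (\<Sum>k=1..nat \<lfloor>y\<rfloor>. totient k)"
  unfolding Delta_def
  by (rule sum.cong) (auto simp: Suc_le_eq le_nat_floor, linarith)

text \<open>
  Grouped by products, the left-hand side becomes a sum over \<open>n\<close> of \<open>\<Sum>d | d dvd n. totient (n div d)\<close>,
  and each inner sum is \<open>n\<close>.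
\<close>
lemma sum_Delta_1_dilations:
  "(\<Sum>d=1..nat \<lfloor>y\<rfloor>. Delta (y / real d) 1) = (\<Sum>n=1..nat \<lfloor>y\<rfloor>. n)"
proof -
  let ?N = "nat \<lfloor>y\<rfloor>"
  have "(\<Sum>d=1..?N. Delta (y / real d) 1) = (\<Sum>d=1..?N. \<Sum>e=1..?N div d. totient e)"
    by (simp add: Delta_1 nat_floor_divide_nat del: One_nat_def)
  also have "\<dots> = (\<Sum>n=1..?N. \<Sum>d | d dvd n. totient (n div d))"
    by (rule sum_over_factorizations)
  also have "\<dots> = (\<Sum>n=1..?N. n)"
  proof (rule sum.cong)
    fix n assume "n \<in> {1..?N}"
    hence "n > 0" by simp
    hence "(\<Sum>d | d dvd n. totient (n div d)) = (\<Sum>d | d dvd n. totient d)"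
      by (intro sum.reindex_bij_witness[where i = "\<lambda>d. n div d" and j = "\<lambda>d. n div d"]) auto
    thus "(\<Sum>d | d dvd n. totient (n div d)) = n"
      by (simp add: totient_divisor_sum)
  qed simp
  finally show ?thesis .
qed

text \<open>
  The partial sums increase to the value of the Basel series, and they decrease to it once \<open>1 / N\<close> is
  added, because \<open>1 / (N + 1)\<^sup>2 \<le> 1 / N - 1 / (N + 1)\<close>.
\<close>
lemma inverse_squares_partial_sum:
  assumes "N > 0"
  shows "(\<Sum>d=1..N. 1 / (real d)\<^sup>2) \<le> pi\<^sup>2 / 6"
    and "pi\<^sup>2 / 6 \<le> (\<Sum>d=1..N. 1 / (real d)\<^sup>2) + 1 / real N"
proof -
  define S where "S N = (\<Sum>d=1..N. 1 / (real d)\<^sup>2)" for N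
  have S_eq: "S n = (\<Sum>k<n. 1 / (real k + 1)\<^sup>2)" for n
    by (induction n) (auto simp: S_def add_ac)
  have lim: "S \<longlonglongrightarrow> pi\<^sup>2 / 6"
    using inverse_squares_sums unfolding sums_def S_eq by (simp add: add_ac)
  have "incseq S"
    by (rule incseq_SucI) (simp add: S_def)
  from incseq_le[OF this lim] show "(\<Sum>d=1..N. 1 / (real d)\<^sup>2) \<le> pi\<^sup>2 / 6"
    by (simp add: S_def)
  have "decseq (\<lambda>n. S (Suc n) + 1 / real (Suc n))"
  proof (rule decseq_SucI)
    fix n
    have "1 / (real n + 2)\<^sup>2 + 1 / (real n + 2) \<le> 1 / (real n + 1)"
      by (simp add: divide_simps power2_eq_square) (simp add: algebra_simps)
    thus "S (Suc (Suc n)) + 1 / real (Suc (Suc n)) \<le> S (Suc n) + 1 / real (Suc n)"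
      by (simp add: S_def add_ac)
  qed
  moreover have "(\<lambda>n. S (Suc n) + 1 / real (Suc n)) \<longlonglongrightarrow> pi\<^sup>2 / 6 + 0"
    by (intro tendsto_add LIMSEQ_Suc lim lim_1_over_n)
  ultimately have "pi\<^sup>2 / 6 + 0 \<le> S (Suc (N - 1)) + 1 / real (Suc (N - 1))"
    by (rule decseq_ge)
  thus "pi\<^sup>2 / 6 \<le> (\<Sum>d=1..N. 1 / (real d)\<^sup>2) + 1 / real N"
    using assms by (simp add: S_def)
qed

lemma three_div_pi_squared_le: "3 / pi\<^sup>2 \<le> 3 / 4"
proof -
  have "pi\<^sup>2 \<ge> 2\<^sup>2"
    by (rule power_mono[OF pi_ge_two]) simp
  thus ?thesis by (simp add: field_simps)
qed

text \<open>
  The two quadratic terms \<open>y\<^sup>2 / 2\<close> cancel.  What remains is \<open>T\<close>, from replacing \<open>y\<close> by its floor, at most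
  \<open>y / 2\<close> in absolute value, and \<open>U\<close>, from the tail of the Basel series, at most \<open>3 / 2 * y\<close>.
\<close>
lemma dilation_sum_bound:
  assumes "y \<ge> 1"
  shows "\<bar>\<Sum>d=1..nat \<lfloor>y\<rfloor>. real (Delta (y / real d) 1) - 3 / pi\<^sup>2 * (y / real d)\<^sup>2\<bar> \<le> 2 * y"
proof -
  let ?N = "nat \<lfloor>y\<rfloor>"
  define S where "S = (\<Sum>d=1..?N. 1 / (real d)\<^sup>2)"
  have N: "real ?N \<le> y" "y < real ?N + 1" "?N \<ge> 1"
    using assms by linarith+
  have gauss: "(\<Sum>n=1..m. real n) = real m * (real m + 1) / 2" for m
    by (induction m) (auto simp: field_simps)
  define T where "T = real ?N * (real ?N + 1) / 2 - y\<^sup>2 / 2"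
  define U where "U = 3 / pi\<^sup>2 * (y\<^sup>2 * (pi\<^sup>2 / 6 - S))"
  have "(\<Sum>d=1..?N. real (Delta (y / real d) 1) - 3 / pi\<^sup>2 * (y / real d)\<^sup>2)
      = real (\<Sum>d=1..?N. Delta (y / real d) 1) - 3 / pi\<^sup>2 * y\<^sup>2 * S"
    by (simp add: sum_subtractf sum_distrib_left S_def power_divide)
  also have "real (\<Sum>d=1..?N. Delta (y / real d) 1) = real ?N * (real ?N + 1) / 2"
    unfolding sum_Delta_1_dilations of_nat_sum by (rule gauss)
  also have "real ?N * (real ?N + 1) / 2 - 3 / pi\<^sup>2 * y\<^sup>2 * S
      = T + U"
    by (simp add: T_def U_def field_simps)
  finally have eq: "(\<Sum>d=1..?N. real (Delta (y / real d) 1) - 3 / pi\<^sup>2 * (y / real d)\<^sup>2)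
      = T + U" .
  have "real ?N * (real ?N + 1) \<le> y * (y + 1)" "(y - 1) * y \<le> real ?N * (real ?N + 1)"
    using N assms by (intro mult_mono; simp)+
  hence "real ?N * (real ?N + 1) \<le> y\<^sup>2 + y" "y\<^sup>2 - y \<le> real ?N * (real ?N + 1)"
    by (simp_all only: power2_eq_square distrib_left left_diff_distrib mult_1 mult_1_right)
  moreover have "\<bar>a / 2 - b / 2\<bar> \<le> y / 2" if "a \<le> b + y" "b - y \<le> a" for a b :: real
    using that by linarith
  ultimately have T: "\<bar>T\<bar> \<le> y / 2"
    unfolding T_def by blast
  have S: "S \<le> pi\<^sup>2 / 6" "pi\<^sup>2 / 6 - S \<le> 1 / real ?N"
    using inverse_squares_partial_sum[of ?N] N by (auto simp: S_def)
  have "y\<^sup>2 * (pi\<^sup>2 / 6 - S) \<le> y\<^sup>2 * (1 / real ?N)"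
    by (intro mult_left_mono S) simp
  also have "\<dots> \<le> 2 * y"
  proof -
    have "y \<le> 2 * real ?N"
      using N by linarith
    hence "y * y \<le> y * (2 * real ?N)"
      using assms by (intro mult_left_mono) auto
    thus ?thesis using N by (simp add: field_simps power2_eq_square)
  qed
  finally have "U \<le> 3 / 4 * (2 * y)"
    unfolding U_def by (rule mult_mono[OF three_div_pi_squared_le]) (use S in auto)
  moreover have "0 \<le> U"
    using S by (simp add: U_def)
  ultimately show ?thesis
    unfolding eq using T by linarith
qed

lemma Delta_1_asymptotics:
  assumes "y \<ge> 1"
  shows "\<bar>real (Delta y 1) - 3 / pi\<^sup>2 * y\<^sup>2\<bar> \<le> 2 * y * (1 + ln y)"
  by (rule bound_from_dilation_sums[where H = "\<lambda>z. real (Delta z 1) - 3 / pi\<^sup>2 * z\<^sup>2"])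
     (use dilation_sum_bound assms in auto)

section \<open>Multiples of a prime\<close>

lemma Delta_eq_0: "y < 1 \<Longrightarrow> Delta y p = 0"
  unfolding Delta_def by (rule sum.neutral) auto

lemma totient_prime_times:
  assumes "prime p"
  shows "totient (p * m) = (p - 1) * totient m + (if p dvd m then totient m else 0)"
proof (cases "p dvd m")
  case True
  have "totient (p * m) = (p - 1) * totient m * p div (p - 1)"
    using True assms by (simp add: totient_mult totient_prime)
  also have "\<dots> = totient m * p"
    using prime_gt_1_nat[OF assms] by (simp add: mult.assoc)
  also have "\<dots> = (p - 1) * totient m + totient m"
    using prime_gt_1_nat[OF assms] by (cases p) auto
  finally show ?thesis using True by simp
next
  case False
  thus ?thesis
    using assms by (simp add: totient_mult_coprime prime_imp_coprime totient_prime)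
qed

lemma finite_nat_le_real: "finite {k::nat. real k \<le> x}"
  by (rule finite_subset[of _ "{..nat \<lfloor>x\<rfloor>}"]) (auto simp: le_nat_floor)

lemma Delta_recurrence:
  assumes "prime p"
  shows "Delta x p = (p - 1) * Delta (x / real p) 1 + Delta (x / real p) p"
proof -
  have p: "p > 0"
    using assms by (rule prime_gt_0_nat)
  let ?M = "{m. 1 \<le> m \<and> real m \<le> x / real p}"
  have fin: "finite ?M"
    by (rule finite_subset[OF _ finite_nat_le_real]) auto
  have "Delta x p = (\<Sum>m\<in>?M. totient (p * m))"
    unfolding Delta_def
    by (rule sum.reindex_bij_witness[where i = "\<lambda>m. p * m" and j = "\<lambda>k. k div p"])
       (use p in \<open>auto simp: field_simps Suc_le_eq elim!: dvdE\<close>)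
  also have "\<dots> = (p - 1) * (\<Sum>m\<in>?M. totient m) + (\<Sum>m\<in>?M. if p dvd m then totient m else 0)"
    by (simp only: totient_prime_times[OF assms] sum.distrib sum_distrib_left)
  also have "(\<Sum>m\<in>?M. if p dvd m then totient m else 0) = Delta (x / real p) p"
    unfolding Delta_def by (subst sum.inter_filter[OF fin, symmetric]) (simp add: conj_assoc)
  also have "(\<Sum>m\<in>?M. totient m) = Delta (x / real p) 1"
    unfolding Delta_def by simp
  finally show ?thesis .
qed

text \<open>
  The logarithm is taken at the fixed upper end \<open>x\<close> and not at \<open>y\<close>, so that the bound is linear in \<open>y\<close>.
  It then satisfies the recurrence with equality, and the induction along \<open>y\<close>, \<open>y / p\<close>, \<open>y / p\<^sup>2\<close>, ...
  loses nothing in the constant.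
\<close>
lemma Delta_error_bound:
  assumes p: "prime p" and y: "0 < y" "y \<le> x" and x: "x \<ge> 1"
  shows "\<bar>real (Delta y p) - 3 / pi\<^sup>2 / (real p + 1) * y\<^sup>2\<bar> \<le> 2 * y * (1 + ln x)"
  using y
proof (induction "nat \<lfloor>y\<rfloor>" arbitrary: y rule: less_induct)
  case less
  define c where "c = 3 / pi\<^sup>2"
  have "c \<le> 3 / 4"
    unfolding c_def by (rule three_div_pi_squared_le)
  hence c: "0 \<le> c" "c \<le> 1"
    by (simp add: c_def, linarith)
  define L where "L = 1 + ln x"
  have L: "L \<ge> 1" using x by (simp add: L_def)
  have p2: "real p \<ge> 2" using prime_ge_2_nat[OF p] by simp
  \<comment> \<open>Below 1 the sums are empty and the error is the main term, where \<open>z\<^sup>2 < z\<close>.\<close>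
  have small: "c * z\<^sup>2 \<le> 2 * z * L" if "0 < z" "z < 1" for z
  proof -
    have "c * (z * z) \<le> 1 * (z * 1)"
      using c that by (intro mult_mono) auto
    also have "\<dots> \<le> z * (2 * L)"
      using L that by simp
    finally show ?thesis by (simp add: power2_eq_square algebra_simps)
  qed
  show ?case
  proof (cases "y < 1")
    case True
    have "c / (real p + 1) * y\<^sup>2 \<le> c * y\<^sup>2"
      using c p2 by (intro mult_right_mono) (auto simp: field_simps)
    also note small[OF less.prems(1) True]
    finally show ?thesis
      using True c p2 unfolding c_def[symmetric] L_def[symmetric]
      by (simp add: Delta_eq_0)
  next
    case False
    define z where "z = y / real p"
    have y_eq: "y = real p * z"
      using p2 by (simp add: z_def)
    have z_le: "z \<le> y / 2"
      using p2 less.prems(1) unfolding z_def by (intro divide_left_mono) auto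
    have z: "0 < z" "z \<le> x"
      using less.prems p2 z_le by (simp add: z_def, linarith)
    have y1: "\<lfloor>y\<rfloor> \<ge> 1"
      using False by simp
    hence "z < real_of_int \<lfloor>y\<rfloor>"
      using z_le by linarith
    hence "nat \<lfloor>z\<rfloor> < nat \<lfloor>y\<rfloor>"
      using y1 by (simp add: floor_less_iff)
    hence IH: "\<bar>real (Delta z p) - c / (real p + 1) * z\<^sup>2\<bar> \<le> 2 * z * L"
      unfolding c_def L_def by (rule less.hyps) (use z in auto)
    have Phi: "\<bar>real (Delta z 1) - c * z\<^sup>2\<bar> \<le> 2 * z * L"
    proof (cases "z < 1")
      case True
      thus ?thesis using small[OF z(1)] c by (simp add: Delta_eq_0)
    next
      case False
      hence "\<bar>real (Delta z 1) - c * z\<^sup>2\<bar> \<le> 2 * z * (1 + ln z)"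
        unfolding c_def by (intro Delta_1_asymptotics) simp
      also have "\<dots> \<le> 2 * z * L"
        using z False by (intro mult_left_mono) (auto simp: L_def)
      finally show ?thesis .
    qed
    \<comment> \<open>The main terms obey the same recurrence: \<open>p\<^sup>2 / (p + 1) = (p - 1) + 1 / (p + 1)\<close>.\<close>
    have "c / (real p + 1) * y\<^sup>2 = (real p - 1) * (c * z\<^sup>2) + c / (real p + 1) * z\<^sup>2"
      using p2 by (simp add: y_eq field_simps power2_eq_square)
    moreover have "real (Delta y p) = (real p - 1) * real (Delta z 1) + real (Delta z p)"
      using p2 by (simp add: Delta_recurrence[OF p, of y] z_def of_nat_diff)
    ultimately have "real (Delta y p) - c / (real p + 1) * y\<^sup>2
        = (real p - 1) * (real (Delta z 1) - c * z\<^sup>2) + (real (Delta z p) - c / (real p + 1) * z\<^sup>2)"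
      by (simp add: algebra_simps)
    also have "\<bar>\<dots>\<bar> \<le> (real p - 1) * (2 * z * L) + 2 * z * L"
    proof (rule order.trans[OF abs_triangle_ineq add_mono[OF _ IH]])
      show "\<bar>(real p - 1) * (real (Delta z 1) - c * z\<^sup>2)\<bar> \<le> (real p - 1) * (2 * z * L)"
        unfolding abs_mult using p2 Phi by (intro mult_mono) auto
    qed
    also have "\<dots> = 2 * y * L"
      by (simp add: y_eq algebra_simps)
    finally show ?thesis
      by (simp only: c_def L_def)
  qed
qed

theorem theorem5p1:
  "\<exists>C::real. \<forall>(p::nat) (x::real). prime p \<longrightarrow> x \<ge> 2 \<longrightarrow>
     \<bar>real (Delta x p) - 3 / (pi\<^sup>2 * (real p + 1)) * x\<^sup>2\<bar> \<le> C * (x * ln x)"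
proof (intro exI[of _ 6] allI impI)
  fix p :: nat and x :: real
  assume p: "prime p" and x: "x \<ge> 2"
  \<comment> \<open>For \<open>x \<ge> 2\<close> the 1 in \<open>1 + ln x\<close> is absorbed by \<open>2 * ln x\<close>, whence the constant \<open>2 * 3\<close>.\<close>
  have "1 / 2 \<le> ln (2::real)"
    using ln_le_minus_one[of "1 / 2 :: real"] by (simp add: ln_div)
  also have "\<dots> \<le> ln x" using x by simp
  finally have "2 * x * (1 + ln x) \<le> 2 * x * (3 * ln x)"
    using x by (intro mult_left_mono) auto
  moreover have "\<bar>real (Delta x p) - 3 / pi\<^sup>2 / (real p + 1) * x\<^sup>2\<bar> \<le> 2 * x * (1 + ln x)"
    using x by (intro Delta_error_bound p) auto
  ultimately show "\<bar>real (Delta x p) - 3 / (pi\<^sup>2 * (real p + 1)) * x\<^sup>2\<bar> \<le> 6 * (x * ln x)"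
    by simp
qed

end
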